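(* The following hold. Let $\mathcal{C}$ be a distinct covering system with least modulus $m$ whose moduli have least common multiple $L = 2^a 3^b 5^c$, where $a,b,c$ are positive integers with $a \geq b \geq c$. Then: (i) If $m=2$, then $a \geq 2$. (iii) If $m=3$ and $a=2$, then $b \geq 2$. Moreover: (ii) There exists a distinct covering system with least modulus $m=2$ and least common multiple of its moduli equal to $2^2\cdot 3^1\cdot 5^1$. (iv) There exists a distinct covering system with least modulus $m=3$ and least common multiple of its moduli equal to $2^2\cdot 3^2\cdot 5^1$, none of whose moduli is $5$ or $180$. (v) There exists a distinct covering system with least modulus $m=3$ and least common multiple of its moduli equal to $2^3\cdot 3^1\cdot 5^1$.
   Context: A covering system is a finite set of congruences $x \equiv r_i \pmod{n_i}$, $i=1,\ldots,k$, such that every integer satisfies at least one of the congruences. A distinct covering system is a covering system in which all moduli $n_i$ are distinct integers greater than $1$. The least modulus $m$ is the smallest of the $n_i$, and $L$ is the least common multiple of all the $n_i$. *)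

theory Defs
  imports "HOL-Number_Theory.Cong"
begin

text \<open>A pair \<open>(r, n)\<close> stands for the congruence \<open>x \<equiv> r (mod n)\<close>.\<close>

type_synonym congruence = "int \<times> nat"

definition moduli :: "congruence set \<Rightarrow> nat set" where
  "moduli C = snd ` C"

definition covering_system :: "congruence set \<Rightarrow> bool" where
  "covering_system C \<longleftrightarrow>
     finite C \<and> (\<forall>(r, n) \<in> C. n > 0) \<and>
     (\<forall>x :: int. \<exists>(r, n) \<in> C. [x = r] (mod int n))"

text \<open>Injectivity of \<open>snd\<close> on \<open>C\<close> says that no two congruences share a modulus.\<close>

definition distinct_covering_system :: "congruence set \<Rightarrow> bool" where
  "distinct_covering_system C \<longleftrightarrow>
     covering_system C \<and> inj_on snd C \<and> (\<forall>n \<in> moduli C. n > 1)"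

text \<open>A covering system is finite and nonempty, so \<open>Min\<close> is the least modulus.\<close>

definition least_modulus :: "congruence set \<Rightarrow> nat" where
  "least_modulus C = Min (moduli C)"

definition lcm_moduli :: "congruence set \<Rightarrow> nat" where
  "lcm_moduli C = Lcm (moduli C)"

end

theory Submission
  imports Defs
begin

text \<open>
  The two nonexistence claims are counting arguments, the three existence claims are explicit
  coverings.

  If \<open>m = 2\<close> and \<open>a = 1\<close>, all moduli divide \<open>30\<close>; if \<open>m = 3\<close>, \<open>a = 2\<close> and \<open>b = 1\<close>, they divide
  \<open>60\<close> and are at least \<open>3\<close>. Take \<open>q = 2\<close> in the first case and \<open>q = 4\<close> in the second.
  The sum of the reciprocals of the possible moduli exceeds \<open>1\<close> in both cases, so the overlaps
  between the classes have to be counted. By the Chinese remainder theorem the covering can be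
  translated so that the classes modulo the pairwise coprime numbers \<open>q\<close>, \<open>3\<close>, \<open>5\<close> are the zero
  classes (\<open>residues_of_distinct_covering\<close>). They leave
  \<open>(q - 1) \<cdot> 2 \<cdot> 4\<close> integers of a period \<open>15 q\<close>, the survivors. Each of the other possible
  moduli meets only a few survivors. For \<open>q = 2\<close> the individual maxima, \<open>4, 2, 1, 1\<close> for the
  moduli \<open>6, 10, 15, 30\<close>, add up to exactly the \<open>8\<close> survivors, and for \<open>q = 4\<close> the maxima
  \<open>8, 4, 4, 3, 2, 2, 1\<close> for \<open>6, 10, 12, 15, 20, 30, 60\<close> add up to exactly the \<open>24\<close> survivors.
  So a covering would need classes that all attain their maximum and share no survivor. The classes modulo
  \<open>6\<close> and \<open>10\<close> cannot do this: to be maximal both have to consist of odd numbers, and then they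
  meet, again by the Chinese remainder theorem, in a survivor. This contradiction gives
  \<open>no_distinct_covering_30\<close> and \<open>no_distinct_covering_60\<close>.

  In the coverings, classes with moduli prime to \<open>5\<close> leave a thin set. For \<open>180\<close> and \<open>120\<close> this
  set is nonempty; it is split modulo \<open>5\<close>, and each part is small enough to be filled with the
  multiples of \<open>5\<close> among the moduli. That they cover is checked on one period
  (\<open>distinct_covering_system_set\<close>).
\<close>

section \<open>Translating a covering\<close>

lemma distinct_covering_residue_function:
  assumes "distinct_covering_system C"
  shows "\<exists>r :: nat \<Rightarrow> int. \<forall>x. \<exists>n \<in> moduli C. [x = r n] (mod int n)"
proof (intro exI allI)
  fix x :: int
  let ?r = "fst \<circ> the_inv_into C snd"
  from assms obtain s n where sn: "(s, n) \<in> C" "[x = s] (mod int n)"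
    unfolding distinct_covering_system_def covering_system_def by blast
  have "the_inv_into C snd n = (s, n)"
    using assms sn(1) the_inv_into_f_f[of snd C "(s, n)"]
    by (simp add: distinct_covering_system_def)
  then show "\<exists>n \<in> moduli C. [x = ?r n] (mod int n)"
    using sn by (force simp: moduli_def)
qed

text \<open>
  A translation of a covering is again a covering. The residue function is total: it also
  assigns a class to numbers that are not moduli. So three pairwise coprime classes can be moved
  to zero simultaneously whether or not the three numbers occur as moduli.
\<close>

lemma residues_of_distinct_covering:
  fixes p q s :: nat
  assumes "distinct_covering_system C"
    and "coprime p q" "coprime p s" "coprime q s"
  shows "\<exists>r :: nat \<Rightarrow> int. (\<forall>n > 0. r n \<in> {0..<int n}) \<and> r p = 0 \<and> r q = 0 \<and> r s = 0 \<and>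
    (\<forall>x. \<exists>n \<in> moduli C. x mod int n = r n)"
proof -
  obtain \<rho> :: "nat \<Rightarrow> int" where \<rho>: "\<And>x. \<exists>n \<in> moduli C. [x = \<rho> n] (mod int n)"
    using distinct_covering_residue_function[OF assms(1)] by blast
  obtain u where u: "[u = \<rho> p] (mod int p)" "[u = \<rho> q] (mod int q)"
    using binary_chinese_remainder_int[of "int p" "int q"] assms(2) by auto
  have "coprime (int p * int q) (int s)"
    using assms(3,4) by simp
  then obtain t where t: "[t = u] (mod int p * int q)" "[t = \<rho> s] (mod int s)"
    using binary_chinese_remainder_int by blast
  have tp: "[t = \<rho> p] (mod int p)"
    using t(1) u(1) cong_modulus_mult cong_trans by blast
  have tq: "[t = \<rho> q] (mod int q)"
    using t(1) u(2) cong_modulus_mult[of t u "int q" "int p"] cong_trans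
    by (metis mult.commute)
  define r where "r n = (\<rho> n - t) mod int n" for n
  have zero: "r n = 0" if "[t = \<rho> n] (mod int n)" for n
    using that by (simp add: r_def cong_iff_dvd_diff dvd_diff_commute mod_eq_0_iff_dvd)
  show ?thesis
  proof (intro exI[of _ r] conjI allI impI)
    show "r n \<in> {0..<int n}" if "0 < n" for n
      using that by (simp add: r_def)
    show "r p = 0" "r q = 0" "r s = 0"
      using tp tq t(2) zero by simp_all
    show "\<exists>n \<in> moduli C. x mod int n = r n" for x
    proof -
      obtain n where n: "n \<in> moduli C" "[x + t = \<rho> n] (mod int n)"
        using \<rho> by blast
      from n(2) have "[x + t - t = \<rho> n - t] (mod int n)"
        by (intro cong_diff cong_refl)
      with n(1) show ?thesis
        by (auto simp: r_def cong_def)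
    qed
  qed
qed

section \<open>Counting the survivors\<close>

definition survivors :: "int \<Rightarrow> int set" where
  "survivors q = {x \<in> {0..<15 * q}. x mod q \<noteq> 0 \<and> x mod 3 \<noteq> 0 \<and> x mod 5 \<noteq> 0}"

definition hits :: "int \<Rightarrow> nat \<Rightarrow> int \<Rightarrow> int set" where
  "hits q n r = {x \<in> survivors q. x mod int n = r}"

lemma survivors_30: "survivors 2 = set [1, 7, 11, 13, 17, 19, 23, 29]"
  by code_simp

lemma survivors_60:
  "survivors 4 = set [1, 2, 7, 11, 13, 14, 17, 19, 22, 23, 26, 29, 
    31, 34, 37, 38, 41, 43, 46, 47, 49, 53, 58, 59]"
  by code_simp

lemma survivors_hit:
  fixes r :: "nat \<Rightarrow> int"
  assumes "\<And>x. \<exists>n \<in> M. x mod int n = r n"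
    and "r q = 0" "r 3 = 0" "r 5 = 0"
  shows "survivors (int q) \<subseteq> (\<Union>n \<in> M - {q, 3, 5}. hits (int q) n (r n))"
proof
  fix x
  assume x: "x \<in> survivors (int q)"
  obtain n where n: "n \<in> M" "x mod int n = r n"
    using assms(1) by blast
  have "n \<notin> {q, 3, 5}"
    using x n(2) assms(2-4) by (auto simp: survivors_def)
  with x n show "x \<in> (\<Union>n \<in> M - {q, 3, 5}. hits (int q) n (r n))"
    by (auto simp: hits_def)
qed

text \<open>
  Modulo \<open>30\<close> the survivors are the odd numbers among \<open>2 \<times> 4\<close> pairs of nonzero residues modulo
  \<open>3\<close> and \<open>5\<close>. An odd class modulo \<open>6\<close> contains a row of \<open>4\<close>, an odd class modulo \<open>10\<close> a column
  of \<open>2\<close>, and a row and a column share a cell, which leaves \<open>4 + 2 - 1\<close>.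
\<close>

lemma card_hits_30:
  "card (survivors 2) = 8"
  "\<forall>r \<in> set [0..5]. \<forall>s \<in> set [0..9]. card (hits 2 6 r \<union> hits 2 10 s) \<le> 5"
  "\<forall>r \<in> set [0..14]. card (hits 2 15 r) \<le> 1"
  "\<forall>r \<in> set [0..29]. card (hits 2 30 r) \<le> 1"
  unfolding hits_def survivors_30 by code_simp+

text \<open>
  Modulo \<open>60\<close> the survivors have one even and two odd residues modulo \<open>4\<close>. The classes modulo
  \<open>6\<close> and \<open>10\<close> contain at most \<open>8\<close> and \<open>4\<close> survivors, and an even class only half as many. If
  both are odd and maximal, they share the two survivors over one pair of residues modulo \<open>3\<close> and
  \<open>5\<close>; if one is even, at least two survivors are lost directly. Hence the bound \<open>10\<close>.
\<close>

lemma card_hits_60: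
  "card (survivors 4) = 24"
  "\<forall>r \<in> set [0..5]. \<forall>s \<in> set [0..9]. card (hits 4 6 r \<union> hits 4 10 s) \<le> 10"
  "\<forall>r \<in> set [0..11]. card (hits 4 12 r) \<le> 4"
  "\<forall>r \<in> set [0..14]. card (hits 4 15 r) \<le> 3"
  "\<forall>r \<in> set [0..19]. card (hits 4 20 r) \<le> 2"
  "\<forall>r \<in> set [0..29]. card (hits 4 30 r) \<le> 2"
  "\<forall>r \<in> set [0..59]. card (hits 4 60 r) \<le> 1"
  unfolding hits_def survivors_60 by code_simp+

lemma finite_hits: "finite (hits q n r)"
  by (rule finite_subset[of _ "{0..<15 * q}"]) (auto simp: hits_def survivors_def)

lemma no_distinct_covering_30:
  assumes "distinct_covering_system C"
  shows "\<not> moduli C \<subseteq> {2, 3, 5, 6, 10, 15, 30}"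
proof
  assume sub: "moduli C \<subseteq> {2, 3, 5, 6, 10, 15, 30}"
  have "coprime (2::nat) 3" "coprime (2::nat) 5" "coprime (3::nat) 5"
    by code_simp+
  then obtain r :: "nat \<Rightarrow> int"
    where range: "\<And>n. 0 < n \<Longrightarrow> r n \<in> {0..<int n}"
      and zero: "r 2 = 0" "r 3 = 0" "r 5 = 0"
      and cov: "\<And>x. \<exists>n \<in> moduli C. x mod int n = r n"
    using residues_of_distinct_covering[OF assms] by meson
  let ?H = "\<lambda>n. hits 2 n (r n)"
  have "survivors 2 \<subseteq> (\<Union>n \<in> moduli C - {2, 3, 5}. ?H n)"
    using survivors_hit[of "moduli C" r 2] cov zero by simp
  also have "\<dots> \<subseteq> (?H 6 \<union> ?H 10) \<union> ?H 15 \<union> ?H 30"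
    using sub by blast
  finally have "card (survivors 2) \<le> card ((?H 6 \<union> ?H 10) \<union> ?H 15 \<union> ?H 30)"
    by (intro card_mono) (simp_all add: finite_hits)
  also have "\<dots> \<le> card (?H 6 \<union> ?H 10) + card (?H 15) + card (?H 30)"
    by (intro order_trans[OF card_Un_le] add_mono order_refl)
  also have "\<dots> \<le> 5 + 1 + 1"
    using range[of 6] range[of 10] range[of 15] range[of 30]
    by (intro add_mono card_hits_30(2-)[rule_format]) simp_all
  finally show False
    by (simp add: card_hits_30(1))
qed

lemma no_distinct_covering_60:
  assumes "distinct_covering_system C"
  shows "\<not> moduli C \<subseteq> {3, 4, 5, 6, 10, 12, 15, 20, 30, 60}"
proof
  assume sub: "moduli C \<subseteq> {3, 4, 5, 6, 10, 12, 15, 20, 30, 60}"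
  have "coprime (4::nat) 3" "coprime (4::nat) 5" "coprime (3::nat) 5"
    by code_simp+
  then obtain r :: "nat \<Rightarrow> int"
    where range: "\<And>n. 0 < n \<Longrightarrow> r n \<in> {0..<int n}"
      and zero: "r 4 = 0" "r 3 = 0" "r 5 = 0"
      and cov: "\<And>x. \<exists>n \<in> moduli C. x mod int n = r n"
    using residues_of_distinct_covering[OF assms] by meson
  let ?H = "\<lambda>n. hits 4 n (r n)"
  have "survivors 4 \<subseteq> (\<Union>n \<in> moduli C - {4, 3, 5}. ?H n)"
    using survivors_hit[of "moduli C" r 4] cov zero by simp
  also have "\<dots> \<subseteq> (?H 6 \<union> ?H 10) \<union> ?H 12 \<union> ?H 15 \<union> ?H 20 \<union> ?H 30 \<union> ?H 60"
    using sub by blast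
  finally have "card (survivors 4) \<le>
      card ((?H 6 \<union> ?H 10) \<union> ?H 12 \<union> ?H 15 \<union> ?H 20 \<union> ?H 30 \<union> ?H 60)"
    by (intro card_mono) (simp_all add: finite_hits)
  also have "\<dots> \<le> card (?H 6 \<union> ?H 10) + card (?H 12) + card (?H 15) + card (?H 20)
      + card (?H 30) + card (?H 60)"
    by (intro order_trans[OF card_Un_le] add_mono order_refl)
  also have "\<dots> \<le> 10 + 4 + 3 + 2 + 2 + 1"
    using range[of 6] range[of 10] range[of 12] range[of 15] range[of 20] range[of 30] range[of 60]
    by (intro add_mono card_hits_60(2-)[rule_format]) simp_all
  finally show False
    by (simp add: card_hits_60(1))
qed

lemma divisors_30:
  fixes n :: nat
  assumes "n dvd 30" "1 < n"
  shows "n \<in> {2, 3, 5, 6, 10, 15, 30}"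
proof -
  have "\<forall>n \<in> set [2..<31]. n dvd 30 \<longrightarrow> n \<in> {2, 3, 5, 6, 10, 15, 30}"
    by code_simp
  moreover have "n \<in> set [2..<31]"
    unfolding set_upt using dvd_imp_le[OF assms(1)] assms(2) by simp
  ultimately show ?thesis
    using assms(1) by blast
qed

lemma divisors_60:
  fixes n :: nat
  assumes "n dvd 60" "2 < n"
  shows "n \<in> {3, 4, 5, 6, 10, 12, 15, 20, 30, 60}"
proof -
  have "\<forall>n \<in> set [3..<61]. n dvd 60 \<longrightarrow> n \<in> {3, 4, 5, 6, 10, 12, 15, 20, 30, 60}"
    by code_simp
  moreover have "n \<in> set [3..<61]"
    unfolding set_upt using dvd_imp_le[OF assms(1)] assms(2) by simp
  ultimately show ?thesis
    using assms(1) by blast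
qed

lemma dvd_lcm_moduli: "n \<in> moduli C \<Longrightarrow> n dvd lcm_moduli C"
  by (simp add: lcm_moduli_def)

lemma least_modulus_le:
  assumes "distinct_covering_system C" "n \<in> moduli C"
  shows "least_modulus C \<le> n"
  using assms
  by (simp add: distinct_covering_system_def covering_system_def least_modulus_def moduli_def)

section \<open>Explicit coverings\<close>

lemma distinct_covering_system_set:
  fixes C :: "congruence list" and L :: nat
  assumes "distinct (map snd C)" "0 < L"
    and moduli: "\<forall>(r, n) \<in> set C. 1 < n \<and> n dvd L"
    and period: "\<forall>x \<in> set [0..int L - 1]. \<exists>(r, n) \<in> set C. x mod int n = r"
  shows "distinct_covering_system (set C)"
proof -
  have "\<exists>(r, n) \<in> set C. [x = r] (mod int n)" for x
  proof -
    have "x mod int L \<in> set [0..int L - 1]"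
      using assms(2) by simp
    then obtain r n where rn: "(r, n) \<in> set C" "x mod int L mod int n = r"
      using period by blast
    then have "int n dvd int L"
      using moduli by auto
    then have "x mod int n = r"
      using rn(2) by (simp add: mod_mod_cancel)
    then have "[x = r] (mod int n)"
      by (auto simp: cong_def)
    with rn(1) show ?thesis
      by blast
  qed
  then show ?thesis
    using assms(1) moduli
    by (fastforce simp: distinct_covering_system_def covering_system_def moduli_def distinct_map)
qed

text \<open>
  The moduli \<open>2, 3, 4, 6, 12\<close> already cover: what the classes modulo \<open>2\<close> and \<open>4\<close> leave is
  \<open>3\<close> modulo \<open>4\<close>, and the other three classes split it modulo \<open>3\<close>. The redundant class
  modulo \<open>5\<close> only raises the least common multiple from \<open>12\<close> to \<open>60\<close>.
\<close>

definition covering_60 :: "congruence list" where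
  "covering_60 = [(0, 2), (1, 4), (0, 3), (1, 6), (11, 12), (0, 5)]"

text \<open>
  The classes modulo \<open>3\<close>, \<open>6\<close>, \<open>12\<close> and \<open>4\<close> leave the numbers that are \<open>1\<close> modulo \<open>3\<close> and not
  divisible by \<open>4\<close>; they are \<open>1\<close>, \<open>4\<close> or \<open>7\<close> modulo \<open>9\<close>. The class modulo \<open>9\<close> removes the
  residue \<open>7\<close>, and those modulo \<open>18\<close> and \<open>36\<close> remove what is left among the even numbers. The
  remaining odd numbers, \<open>1\<close> or \<open>4\<close> modulo \<open>9\<close>, are split modulo \<open>5\<close>: the residues \<open>4, 3, 0\<close>
  take one class each (\<open>10, 15, 30\<close>), the residue \<open>1\<close> takes one class for each residue modulo
  \<open>9\<close> (\<open>90, 45\<close>), and the residue \<open>2\<close> one for each odd residue modulo \<open>4\<close> (\<open>20, 60\<close>).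
\<close>

definition covering_180 :: "congruence list" where
  "covering_180 =
    [(0, 3), (0, 4), (5, 6), (2, 12), (7, 9), (10, 18), (22, 36),
     (9, 10), (13, 15), (25, 30), (1, 90), (31, 45), (17, 20), (7, 60)]"

text \<open>
  The classes with moduli prime to \<open>5\<close> leave the numbers that are \<open>2\<close> modulo \<open>3\<close> and either \<open>3\<close>
  modulo \<open>4\<close> or \<open>2\<close> modulo \<open>8\<close>. Modulo \<open>5\<close>, the residues \<open>0\<close> and \<open>1\<close> are removed in both parts
  by the classes modulo \<open>5\<close> and \<open>15\<close>. The residues \<open>3, 2, 4\<close> are removed from the odd part by
  the classes modulo \<open>10, 20, 60\<close>, and the residues \<open>2, 4, 3\<close> from the even part by those modulo
  \<open>30, 40, 120\<close>.
\<close>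

definition covering_120 :: "congruence list" where
  "covering_120 =
    [(0, 3), (0, 4), (1, 6), (5, 12), (6, 8), (10, 24),
     (0, 5), (11, 15), (3, 10), (7, 20), (59, 60), (2, 30), (34, 40), (98, 120)]"

lemma covering_60:
  "distinct_covering_system (set covering_60)"
  "least_modulus (set covering_60) = 2"
  "lcm_moduli (set covering_60) = 2 ^ 2 * 3 ^ 1 * 5 ^ 1"
proof -
  show "distinct_covering_system (set covering_60)"
    by (rule distinct_covering_system_set[where L = 60]; code_simp)
qed (simp_all add: covering_60_def least_modulus_def lcm_moduli_def moduli_def
    lcm_nat_def gcd_non_0_nat)

lemma covering_180:
  "distinct_covering_system (set covering_180)"
  "least_modulus (set covering_180) = 3"
  "lcm_moduli (set covering_180) = 2 ^ 2 * 3 ^ 2 * 5 ^ 1"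
  "5 \<notin> moduli (set covering_180)" "180 \<notin> moduli (set covering_180)"
proof -
  show "distinct_covering_system (set covering_180)"
    by (rule distinct_covering_system_set[where L = 180]; code_simp)
qed (simp_all add: covering_180_def least_modulus_def lcm_moduli_def moduli_def
    lcm_nat_def gcd_non_0_nat)

lemma covering_120:
  "distinct_covering_system (set covering_120)"
  "least_modulus (set covering_120) = 3"
  "lcm_moduli (set covering_120) = 2 ^ 3 * 3 ^ 1 * 5 ^ 1"
proof -
  show "distinct_covering_system (set covering_120)"
    by (rule distinct_covering_system_set[where L = 120]; code_simp)
qed (simp_all add: covering_120_def least_modulus_def lcm_moduli_def moduli_def
    lcm_nat_def gcd_non_0_nat)

section \<open>The extremal exponents\<close>

theorem theorem1p5:
  shows
    "(\<forall>C (a :: nat) (b :: nat) (c :: nat).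
        distinct_covering_system C \<and> lcm_moduli C = 2 ^ a * 3 ^ b * 5 ^ c \<and>
        0 < a \<and> 0 < b \<and> 0 < c \<and> a \<ge> b \<and> b \<ge> c \<longrightarrow>
          (least_modulus C = 2 \<longrightarrow> a \<ge> 2) \<and>
          (least_modulus C = 3 \<and> a = 2 \<longrightarrow> b \<ge> 2)) \<and>
     (\<exists>C. distinct_covering_system C \<and> least_modulus C = 2 \<and>
        lcm_moduli C = 2 ^ 2 * 3 ^ 1 * 5 ^ 1) \<and>
     (\<exists>C. distinct_covering_system C \<and> least_modulus C = 3 \<and>
        lcm_moduli C = 2 ^ 2 * 3 ^ 2 * 5 ^ 1 \<and> 5 \<notin> moduli C \<and> 180 \<notin> moduli C) \<and>
     (\<exists>C. distinct_covering_system C \<and> least_modulus C = 3 \<and>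
        lcm_moduli C = 2 ^ 3 * 3 ^ 1 * 5 ^ 1)"
proof (intro conjI allI impI)
  fix C and a b c :: nat
  assume asm: "distinct_covering_system C \<and> lcm_moduli C = 2 ^ a * 3 ^ b * 5 ^ c \<and>
    0 < a \<and> 0 < b \<and> 0 < c \<and> a \<ge> b \<and> b \<ge> c"
  then have C: "distinct_covering_system C"
    by simp
  show "2 \<le> a" if "least_modulus C = 2"
  proof (rule ccontr)
    assume "\<not> 2 \<le> a"
    with asm have "a = 1" "b = 1" "c = 1"
      by linarith+
    with asm have lcm: "lcm_moduli C = 30"
      by simp
    have "moduli C \<subseteq> {2, 3, 5, 6, 10, 15, 30}"
    proof
      fix n
      assume n: "n \<in> moduli C"
      then have "n dvd 30" "1 < n"
        using dvd_lcm_moduli[OF n] lcm least_modulus_le[OF C n] that by simp_all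
      then show "n \<in> {2, 3, 5, 6, 10, 15, 30}"
        by (rule divisors_30)
    qed
    with no_distinct_covering_30[OF C] show False ..
  qed
  show "2 \<le> b" if "least_modulus C = 3 \<and> a = 2"
  proof (rule ccontr)
    assume "\<not> 2 \<le> b"
    with asm have "b = 1" "c = 1"
      by linarith+
    with asm that have lcm: "lcm_moduli C = 60"
      by simp
    have "moduli C \<subseteq> {3, 4, 5, 6, 10, 12, 15, 20, 30, 60}"
    proof
      fix n
      assume n: "n \<in> moduli C"
      then have "n dvd 60" "2 < n"
        using dvd_lcm_moduli[OF n] lcm least_modulus_le[OF C n] that by simp_all
      then show "n \<in> {3, 4, 5, 6, 10, 12, 15, 20, 30, 60}"
        by (rule divisors_60)
    qed
    with no_distinct_covering_60[OF C] show False ..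
  qed
next
  show "\<exists>C. distinct_covering_system C \<and> least_modulus C = 2 \<and>
      lcm_moduli C = 2 ^ 2 * 3 ^ 1 * 5 ^ 1"
    using covering_60 by blast
next
  show "\<exists>C. distinct_covering_system C \<and> least_modulus C = 3 \<and>
      lcm_moduli C = 2 ^ 2 * 3 ^ 2 * 5 ^ 1 \<and> 5 \<notin> moduli C \<and> 180 \<notin> moduli C"
    using covering_180 by blast
next
  show "\<exists>C. distinct_covering_system C \<and> least_modulus C = 3 \<and>
      lcm_moduli C = 2 ^ 3 * 3 ^ 1 * 5 ^ 1"
    using covering_120 by blast
qed

end
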